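(* Let $S$ be the subgraph of the Kneser graph $K(8,3)$ with the 16 vertices (writing $abc$ for the subset $\{a,b,c\}$) $$v_1=357,\ v_2=468,\ v_3=128,\ v_4=146,\ v_5=148,\ v_6=168,\ v_7=127,\ v_8=235,$$ $$v_9=237,\ v_{10}=257,\ v_{11}=346,\ v_{12}=345,\ v_{13}=258,\ v_{14}=458,\ v_{15}=167,\ v_{16}=367,$$ and the following 36 edges: $v_1v_j$ for $j\in\{2,3,4,5,6\}$; $v_2v_j$ for $j\in\{7,8,9,10\}$; $v_3v_j$ for $j\in\{11,12,16\}$; $v_7v_j$ for $j\in\{11,12,14\}$; $v_4v_j$ for $j\in\{8,9,10,13\}$; $v_5v_j$ for $j\in\{8,9,10,16\}$; $v_6v_j$ for $j\in\{8,9,10,12\}$; $v_8v_{15}$; $v_9v_{14}$; $v_{10}v_{11}$; $v_{13}v_j$ for $j\in\{11,15,16\}$; $v_{14}v_j$ for $j\in\{15,16\}$; $v_{12}v_{15}$. Then $S$ is not semi-transitive, and thus $K(8,3)$ is not semi-transitive.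
   Context: The Kneser graph $K(8,3)$ is the simple undirected graph whose vertices are the $3$-element subsets of $\{1,2,\ldots,8\}$, where two distinct vertices are adjacent if and only if the corresponding subsets are disjoint. An orientation of a simple undirected graph (a choice of exactly one direction for each edge) is semi-transitive if it is acyclic (has no directed cycles) and, for any directed path $v_0\rightarrow v_1\rightarrow\cdots\rightarrow v_k$, either there is no edge between $v_0$ and $v_k$, or $v_i\rightarrow v_j$ is an edge for all $0\leq i<j\leq k$ (here $v_0,\ldots,v_k$ denote arbitrary vertices of the path). An undirected graph is semi-transitive if it admits a semi-transitive orientation. *)

theory Defs
  imports Main
begin

record 'a ugraph =
  verts :: "'a set"
  edges :: "'a set set"

definition simple_graph :: "'a ugraph \<Rightarrow> bool" where
  "simple_graph G \<longleftrightarrow> (\<forall>e \<in> edges G. \<exists>u \<in> verts G. \<exists>v \<in> verts G. u \<noteq> v \<and> e = {u, v})"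

definition subgraph :: "'a ugraph \<Rightarrow> 'a ugraph \<Rightarrow> bool" where
  "subgraph H G \<longleftrightarrow> simple_graph H \<and> simple_graph G \<and>
     verts H \<subseteq> verts G \<and> edges H \<subseteq> edges G"

definition kneser :: "nat \<Rightarrow> nat \<Rightarrow> nat set ugraph" where
  "kneser n k =
     (let V = {A. A \<subseteq> {1..n} \<and> card A = k}
      in \<lparr> verts = V, edges = {{A, B} | A B. A \<in> V \<and> B \<in> V \<and> A \<noteq> B \<and> A \<inter> B = {}} \<rparr>)"

text \<open>An orientation is given by its set of arcs; \<open>(u, v)\<close> stands for \<open>u \<rightarrow> v\<close>.\<close>

definition orientation :: "'a ugraph \<Rightarrow> ('a \<times> 'a) set \<Rightarrow> bool" where
  "orientation G A \<longleftrightarrow>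
     (\<forall>(u, v) \<in> A. {u, v} \<in> edges G) \<and>
     (\<forall>u v. {u, v} \<in> edges G \<longrightarrow> ((u, v) \<in> A \<longleftrightarrow> (v, u) \<notin> A))"

definition directed_path :: "('a \<times> 'a) set \<Rightarrow> 'a list \<Rightarrow> bool" where
  "directed_path A p \<longleftrightarrow> p \<noteq> [] \<and> distinct p \<and>
     (\<forall>i. Suc i < length p \<longrightarrow> (p ! i, p ! Suc i) \<in> A)"

definition semi_transitive_orientation :: "'a ugraph \<Rightarrow> ('a \<times> 'a) set \<Rightarrow> bool" where
  "semi_transitive_orientation G A \<longleftrightarrow>
     orientation G A \<and> acyclic A \<and>
     (\<forall>p. directed_path A p \<longrightarrow>
        {hd p, last p} \<notin> edges G \<or>
        (\<forall>i j. i < j \<and> j < length p \<longrightarrow> (p ! i, p ! j) \<in> A))"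

definition semi_transitive :: "'a ugraph \<Rightarrow> bool" where
  "semi_transitive G \<longleftrightarrow> (\<exists>A. semi_transitive_orientation G A)"

text \<open>The vertices \<open>v\<^sub>1, \<dots>, v\<^sub>1\<^sub>6\<close> of \<open>S\<close>; list positions start at 0.\<close>

definition vS :: "nat \<Rightarrow> nat set" where
  "vS i =
     [{3,5,7}, {4,6,8}, {1,2,8}, {1,4,6}, {1,4,8}, {1,6,8}, {1,2,7}, {2,3,5},
      {2,3,7}, {2,5,7}, {3,4,6}, {3,4,5}, {2,5,8}, {4,5,8}, {1,6,7}, {3,6,7}] ! (i - 1)"

definition S :: "nat set ugraph" where
  "S = \<lparr> verts = vS ` {1..16},
         edges =
           {{vS 1, vS j} | j. j \<in> {2, 3, 4, 5, 6}} \<union>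
           {{vS 2, vS j} | j. j \<in> {7, 8, 9, 10}} \<union>
           {{vS 3, vS j} | j. j \<in> {11, 12, 16}} \<union>
           {{vS 7, vS j} | j. j \<in> {11, 12, 14}} \<union>
           {{vS 4, vS j} | j. j \<in> {8, 9, 10, 13}} \<union>
           {{vS 5, vS j} | j. j \<in> {8, 9, 10, 16}} \<union>
           {{vS 6, vS j} | j. j \<in> {8, 9, 10, 12}} \<union>
           {{vS 8, vS 15}, {vS 9, vS 14}, {vS 10, vS 11}} \<union>
           {{vS 13, vS j} | j. j \<in> {11, 15, 16}} \<union>
           {{vS 14, vS j} | j. j \<in> {15, 16}} \<union>
           {{vS 12, vS 15}} \<rparr>"

lemma simple_graph_kneser: "simple_graph (kneser n k)"
  unfolding simple_graph_def
proof
  fix e assume "e \<in> edges (kneser n k)"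
  then obtain A B where "A \<in> verts (kneser n k)" "B \<in> verts (kneser n k)" "A \<noteq> B" "e = {A, B}"
    unfolding kneser_def Let_def by auto
  then show "\<exists>u\<in>verts (kneser n k). \<exists>v\<in>verts (kneser n k). u \<noteq> v \<and> e = {u, v}"
    by blast
qed

lemma vS_simps:
  "vS 1 = {3,5,7}" "vS 2 = {4,6,8}" "vS 3 = {1,2,8}" "vS 4 = {1,4,6}"
  "vS 5 = {1,4,8}" "vS 6 = {1,6,8}" "vS 7 = {1,2,7}" "vS 8 = {2,3,5}"
  "vS 9 = {2,3,7}" "vS 10 = {2,5,7}" "vS 11 = {3,4,6}" "vS 12 = {3,4,5}"
  "vS 13 = {2,5,8}" "vS 14 = {4,5,8}" "vS 15 = {1,6,7}" "vS 16 = {3,6,7}"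
  by (simp_all add: vS_def)

lemma verts_S:
  "verts S = {vS 1, vS 2, vS 3, vS 4, vS 5, vS 6, vS 7, vS 8,
              vS 9, vS 10, vS 11, vS 12, vS 13, vS 14, vS 15, vS 16}"
proof -
  have "{1..16::nat} = {1,2,3,4,5,6,7,8,9,10,11,12,13,14,15,16}"
    by (rule set_eqI) (simp only: atLeastAtMost_iff insert_iff empty_iff, presburger)
  then show ?thesis by (simp add: S_def)
qed

lemma edges_S:
  "edges S =
    {{vS 1, vS 2}, {vS 1, vS 3}, {vS 1, vS 4}, {vS 1, vS 5}, {vS 1, vS 6},
     {vS 2, vS 7}, {vS 2, vS 8}, {vS 2, vS 9}, {vS 2, vS 10},
     {vS 3, vS 11}, {vS 3, vS 12}, {vS 3, vS 16},
     {vS 7, vS 11}, {vS 7, vS 12}, {vS 7, vS 14},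
     {vS 4, vS 8}, {vS 4, vS 9}, {vS 4, vS 10}, {vS 4, vS 13},
     {vS 5, vS 8}, {vS 5, vS 9}, {vS 5, vS 10}, {vS 5, vS 16},
     {vS 6, vS 8}, {vS 6, vS 9}, {vS 6, vS 10}, {vS 6, vS 12},
     {vS 8, vS 15}, {vS 9, vS 14}, {vS 10, vS 11},
     {vS 13, vS 11}, {vS 13, vS 15}, {vS 13, vS 16},
     {vS 14, vS 15}, {vS 14, vS 16}, {vS 12, vS 15}}"
  unfolding S_def
  by (simp only: ugraph.simps Setcompr_eq_image image_insert image_empty Un_insert_left
      Un_empty_left Un_assoc)

lemma kneser_edgeI:
  assumes "A \<in> verts (kneser n k)" "B \<in> verts (kneser n k)" "A \<noteq> {}" "A \<inter> B = {}"
  shows "{A, B} \<in> edges (kneser n k)"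
proof -
  have "A \<noteq> B" using assms by blast
  then show ?thesis using assms unfolding kneser_def Let_def ugraph.simps by blast
qed

lemma subgraph_S_kneser: "subgraph S (kneser 8 3)"
proof -
  have V: "verts S \<subseteq> verts (kneser 8 3)"
    unfolding verts_S vS_simps kneser_def Let_def by simp
  have E: "edges S \<subseteq> edges (kneser 8 3)"
    unfolding edges_S insert_subset
    by (intro conjI kneser_edgeI empty_subsetI subsetD[OF V];
        (simp only: verts_S insert_iff simp_thms; fail | simp only: vS_simps, simp; fail))
  have "simple_graph S"
    unfolding simple_graph_def
  proof
    fix e assume e: "e \<in> edges S"
    then have "e \<in> edges (kneser 8 3)" using E by blast
    then obtain A B where AB: "A \<noteq> B" "e = {A, B}"
      unfolding kneser_def Let_def by auto
    have "e \<subseteq> verts S"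
      using e unfolding edges_S verts_S by (elim insertE emptyE) simp_all
    then show "\<exists>u\<in>verts S. \<exists>v\<in>verts S. u \<noteq> v \<and> e = {u, v}"
      using AB by blast
  qed
  then show ?thesis
    using V E simple_graph_kneser unfolding subgraph_def by blast
qed

end

theory Submission
  imports Defs
begin

text \<open>
  Both graphs are triangle-free, as three disjoint triples need nine points. In a semi-transitive
  orientation of a triangle-free graph no directed path of three arcs joins adjacent vertices: the
  path would have to induce a transitive tournament. Hence, giving each edge the sign \<open>+1\<close> or \<open>-1\<close>
  according to whether it is traversed along or against its direction, every 4-cycle has sign
  sum \<open>0\<close> (lemma \<open>parallel_2_walks\<close>).

  The graph \<open>S\<close> consists of a \<open>K\<^sub>4\<^sub>,\<^sub>4\<close> on vertices \<open>a\<^sub>0, \<dots>, a\<^sub>7\<close> (even against odd indices), a Wagner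
  graph on \<open>w\<^sub>0, \<dots>, w\<^sub>7\<close> (the 8-cycle in cyclic order together with the chords \<open>w\<^sub>i w\<^sub>i\<^sub>+\<^sub>4\<close>), and the
  perfect matching \<open>a\<^sub>i w\<^sub>i\<close>. The sign sum of a closed walk is \<open>0\<close> whenever the
  walk is a combination of 4-cycles, even a rational one, and this leads to a contradiction:

  \<^item> The rim \<open>w\<^sub>0 \<dots> w\<^sub>7 w\<^sub>0\<close> and the closed walk \<open>a\<^sub>0 \<dots> a\<^sub>7 a\<^sub>0\<close> bound an annulus of eight 4-cycles
    \<open>a\<^sub>i a\<^sub>i\<^sub>+\<^sub>1 w\<^sub>i\<^sub>+\<^sub>1 w\<^sub>i\<close>, so they have the same sign sum; the latter is a sum of three 4-cycles of
    \<open>K\<^sub>4\<^sub>,\<^sub>4\<close>. So the rim has sum \<open>0\<close>.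
  \<^item> The 4-cycles \<open>w\<^sub>i w\<^sub>i\<^sub>+\<^sub>1 w\<^sub>i\<^sub>+\<^sub>5 w\<^sub>i\<^sub>+\<^sub>4\<close> of the Wagner graph form a Moebius band, whose boundary is the
    rim and runs twice around the band. The 5-cycle \<open>w\<^sub>0 w\<^sub>1 w\<^sub>2 w\<^sub>3 w\<^sub>4 w\<^sub>0\<close> runs once around it, so twice
    its sum is the sum of the rim.

  Thus five signs \<open>\<plusminus>1\<close> would add up to \<open>0\<close>, which parity forbids. The argument needs only a
  homomorphic image of \<open>S\<close> in a triangle-free graph, and so it covers \<open>S\<close> and \<open>K(8,3)\<close> at once
  (lemma \<open>no_semi_transitive_orientation\<close>).
\<close>

section \<open>Signs along walks in triangle-free graphs\<close>

definition triangle_free :: "'a ugraph \<Rightarrow> bool" where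
  "triangle_free G \<longleftrightarrow>
     (\<forall>u v w. {u, v} \<in> edges G \<longrightarrow> {v, w} \<in> edges G \<longrightarrow> {u, w} \<notin> edges G)"

definition arc_sign :: "('a \<times> 'a) set \<Rightarrow> 'a \<Rightarrow> 'a \<Rightarrow> int" where
  "arc_sign A u v = (if (u, v) \<in> A then 1 else -1)"

lemma odd_arc_sign: "odd (arc_sign A u v)"
  by (simp add: arc_sign_def)

lemma arc_sign_swap:
  assumes "orientation G A" "{u, v} \<in> edges G"
  shows "arc_sign A v u = - arc_sign A u v"
  using assms by (auto simp: arc_sign_def orientation_def)

lemma no_directed_3_path:
  assumes so: "semi_transitive_orientation G A" and tf: "triangle_free G"
    and arcs: "(u, v) \<in> A" "(v, w) \<in> A" "(w, x) \<in> A"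
    and distinct: "distinct [u, v, w, x]"
  shows "{u, x} \<notin> edges G"
proof
  assume ux: "{u, x} \<in> edges G"
  have "directed_path A [u, v, w, x]"
    using arcs distinct by (auto simp: directed_path_def less_Suc_eq nth_Cons')
  with so ux have "\<forall>i j. i < j \<and> j < 4 \<longrightarrow> ([u, v, w, x] ! i, [u, v, w, x] ! j) \<in> A"
    by (force simp: semi_transitive_orientation_def)
  from this[rule_format, of 0 2] have "(u, w) \<in> A" by simp
  with so arcs have "{u, v} \<in> edges G" "{v, w} \<in> edges G" "{u, w} \<in> edges G"
    by (auto simp: semi_transitive_orientation_def orientation_def)
  with tf show False by (auto simp: triangle_free_def)
qed

text \<open>Four signs in cyclic order sum to \<open>0\<close> as soon as no three consecutive ones agree. Degenerate
  4-cycles are admitted: if opposite vertices coincide, the sum cancels by itself.\<close>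

lemma parallel_2_walks:
  assumes so: "semi_transitive_orientation G A" and tf: "triangle_free G"
    and e: "{u, v} \<in> edges G" "{v, w} \<in> edges G" "{u, x} \<in> edges G" "{x, w} \<in> edges G"
  shows "arc_sign A u v + arc_sign A v w = arc_sign A u x + arc_sign A x w"
proof (cases "u = w \<or> v = x")
  case True
  have "orientation G A" using so by (simp add: semi_transitive_orientation_def)
  from arc_sign_swap[OF this e(1)] arc_sign_swap[OF this e(3)] True show ?thesis
    by auto
next
  case False
  have irrefl: "{y, y} \<notin> edges G" for y
    using tf unfolding triangle_free_def by blast
  have ori: "((y, z) \<in> A) = ((z, y) \<notin> A)" if "{y, z} \<in> edges G" for y z
    using so that by (auto simp: semi_transitive_orientation_def orientation_def)
  have d: "u \<noteq> v" "v \<noteq> w" "u \<noteq> x" "x \<noteq> w" "u \<noteq> w" "v \<noteq> x"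
    using e irrefl False by auto
  have e': "{x, u} \<in> edges G" "{w, x} \<in> edges G" "{v, u} \<in> edges G" "{w, v} \<in> edges G"
    using e by (simp_all add: insert_commute)
  note n = no_directed_3_path[OF so tf]
  have "\<not> ((u, v) \<in> A \<and> (v, w) \<in> A \<and> (w, x) \<in> A)"
    "\<not> ((v, w) \<in> A \<and> (w, x) \<in> A \<and> (x, u) \<in> A)"
    "\<not> ((w, x) \<in> A \<and> (x, u) \<in> A \<and> (u, v) \<in> A)"
    "\<not> ((x, u) \<in> A \<and> (u, v) \<in> A \<and> (v, w) \<in> A)"
    "\<not> ((x, w) \<in> A \<and> (w, v) \<in> A \<and> (v, u) \<in> A)"
    "\<not> ((u, x) \<in> A \<and> (x, w) \<in> A \<and> (w, v) \<in> A)"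
    "\<not> ((v, u) \<in> A \<and> (u, x) \<in> A \<and> (x, w) \<in> A)"
    "\<not> ((w, v) \<in> A \<and> (v, u) \<in> A \<and> (u, x) \<in> A)"
    using n[of u v w x] n[of v w x u] n[of w x u v] n[of x u v w]
      n[of x w v u] n[of u x w v] n[of v u x w] n[of w v u x] d e e'
    by auto
  then show ?thesis
    unfolding arc_sign_def ori[OF e'(1)] ori[OF e'(2)] ori[OF e'(3)] ori[OF e'(4)]
    by (cases "(u, v) \<in> A"; cases "(v, w) \<in> A"; cases "(u, x) \<in> A"; cases "(x, w) \<in> A") simp_all
qed

section \<open>A Wagner graph matched to a complete bipartite graph\<close>

lemma sum_lessThan_8:
  fixes f :: "nat \<Rightarrow> int"
  shows "(\<Sum>i<8. f i) = f 0 + f 1 + f 2 + f 3 + f 4 + f 5 + f 6 + f 7"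
  by (simp add: eval_nat_numeral)

lemma no_semi_transitive_orientation:
  fixes a w :: "nat \<Rightarrow> 'a"
  assumes tf: "triangle_free G"
    and bipartite: "\<And>i j. i < 8 \<Longrightarrow> j < 8 \<Longrightarrow> even i \<Longrightarrow> odd j \<Longrightarrow> {a i, a j} \<in> edges G"
    and matching: "\<And>i. i < 8 \<Longrightarrow> {a i, w i} \<in> edges G"
    and rim: "\<And>i. i < 8 \<Longrightarrow> {w i, w (Suc i mod 8)} \<in> edges G"
    and chord: "\<And>i. i < 4 \<Longrightarrow> {w i, w (i + 4)} \<in> edges G"
  shows "\<not> semi_transitive G"
proof
  assume "semi_transitive G"
  then obtain A where so: "semi_transitive_orientation G A"
    by (auto simp: semi_transitive_def)
  then have ori: "orientation G A"
    by (simp add: semi_transitive_orientation_def)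
  define s where "s = arc_sign A"
  note walks = parallel_2_walks[OF so tf, folded s_def]
  note swap = arc_sign_swap[OF ori, folded s_def]

  have aa: "{a i, a j} \<in> edges G" if "i < 8" "j < 8" "odd (i + j)" for i j
    using that bipartite[of i j] bipartite[of j i] by (auto simp: insert_commute)
  have annulus: "s (a i) (a (Suc i mod 8)) + s (a (Suc i mod 8)) (w (Suc i mod 8))
      = s (a i) (w i) + s (w i) (w (Suc i mod 8))" if "i < 8" for i
  proof -
    have "odd (i + Suc i mod 8)" using that by (cases "i = 7") auto
    then show ?thesis
      using that by (intro walks aa matching rim) auto
  qed
  have rim_eq: "(\<Sum>i<8. s (w i) (w (Suc i mod 8))) = (\<Sum>i<8. s (a i) (a (Suc i mod 8)))"
    using annulus[of 0] annulus[of 1] annulus[of 2] annulus[of 3] annulus[of 4]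
      annulus[of 5] annulus[of 6] annulus[of 7]
    by (simp add: sum_lessThan_8 flip: numeral_2_eq_2)
  have a_zero: "(\<Sum>i<8. s (a i) (a (Suc i mod 8))) = 0"
  proof -
    have "s (a 0) (a 1) + s (a 1) (a 2) = s (a 0) (a 3) + s (a 3) (a 2)"
      "s (a 0) (a 3) + s (a 3) (a 4) = s (a 0) (a 5) + s (a 5) (a 4)"
      "s (a 0) (a 5) + s (a 5) (a 6) = s (a 0) (a 7) + s (a 7) (a 6)"
      by (intro walks aa; simp)+
    moreover have "s (a 3) (a 2) = - s (a 2) (a 3)" "s (a 5) (a 4) = - s (a 4) (a 5)"
      "s (a 7) (a 6) = - s (a 6) (a 7)" "s (a 7) (a 0) = - s (a 0) (a 7)"
      by (intro swap aa; simp)+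
    ultimately show ?thesis
      by (simp add: sum_lessThan_8 flip: numeral_2_eq_2)
  qed

  let ?c = "\<lambda>i. s (w i) (w (i + 4))"
  have band: "s (w i) (w (Suc i)) + ?c (Suc i) = ?c i + s (w (i + 4)) (w (Suc i + 4))"
    if "i < 3" for i
    using that rim[of i] rim[of "i + 4"] by (intro walks chord) auto
  \<comment> \<open>The last 4-cycle of the band is glued with a twist: the chord \<open>w\<^sub>0 w\<^sub>4\<close> returns reversed.\<close>
  have twist: "s (w 3) (w 4) + s (w 4) (w 0) = ?c 3 + s (w 7) (w 0)"
    using walks[of "w 3" "w 4" "w 0" "w 7"] rim[of 3] rim[of 7] chord[of 0] chord[of 3]
    by (simp add: insert_commute)
  have "s (w 4) (w 0) = - ?c 0"
    using chord[of 0] by (simp add: swap)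
  define D where "D = s (w 0) (w 1) + s (w 1) (w 2) + s (w 2) (w 3) + s (w 3) (w 4) + s (w 4) (w 0)"
  have "2 * D = (\<Sum>i<8. s (w i) (w (Suc i mod 8)))"
    using band[of 0] band[of 1] band[of 2] twist \<open>s (w 4) (w 0) = - ?c 0\<close>
    by (simp add: D_def sum_lessThan_8 flip: numeral_2_eq_2)
  with rim_eq a_zero have "D = 0" by simp
  moreover have "odd D"
    by (simp add: D_def s_def odd_arc_sign)
  ultimately show False by simp
qed

section \<open>The Kneser graph and its subgraph\<close>

lemma triangle_free_kneser:
  assumes "n < 3 * k"
  shows "triangle_free (kneser n k)"
  unfolding triangle_free_def
proof (intro allI impI notI)
  fix X Y Z
  assume "{X, Y} \<in> edges (kneser n k)" "{Y, Z} \<in> edges (kneser n k)" "{X, Z} \<in> edges (kneser n k)"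
  then have sub: "X \<union> Y \<union> Z \<subseteq> {1..n}" and card: "card X = k" "card Y = k" "card Z = k"
    and disj: "X \<inter> Y = {}" "Y \<inter> Z = {}" "X \<inter> Z = {}"
    by (auto simp: kneser_def Let_def doubleton_eq_iff)
  then have "finite X" "finite Y" "finite Z"
    by (auto intro: finite_subset)
  then have "card (X \<union> Y \<union> Z) = 3 * k"
    using card disj by (simp add: card_Un_disjoint Int_Un_distrib2)
  moreover have "card (X \<union> Y \<union> Z) \<le> n"
    using card_mono[OF _ sub] by simp
  ultimately show False using assms by simp
qed

lemma triangle_free_subgraph:
  "triangle_free G \<Longrightarrow> edges H \<subseteq> edges G \<Longrightarrow> triangle_free H"
  unfolding triangle_free_def by blast

text \<open>Here \<open>K\<^sub>4\<^sub>,\<^sub>4\<close> has the parts \<open>v\<^sub>1, v\<^sub>8, v\<^sub>9, v\<^sub>1\<^sub>0\<close> and \<open>v\<^sub>2, v\<^sub>4, v\<^sub>5, v\<^sub>6\<close>; the other eight vertices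
  induce the Wagner graph, and the rim is chosen so that its matching partners alternate between
  the two parts.\<close>

lemma no_semi_transitive_orientation_above_S:
  assumes sub: "edges S \<subseteq> edges G" and tf: "triangle_free G"
  shows "\<not> semi_transitive G"
proof (rule no_semi_transitive_orientation[OF tf])
  let ?a = "\<lambda>i. vS ([1, 6, 8, 4, 10, 2, 9, 5] ! i)"
  let ?w = "\<lambda>i. vS ([3, 12, 15, 13, 11, 7, 14, 16] ! i)"
  have less_8: "i = 0 \<or> i = 1 \<or> i = 2 \<or> i = 3 \<or> i = 4 \<or> i = 5 \<or> i = 6 \<or> i = 7"
    if "i < 8" for i :: nat
    using that by linarith
  note e = sub[unfolded edges_S insert_subset]
  show "{?a i, ?a j} \<in> edges G" if "i < 8" "j < 8" "even i" "odd j" for i j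
  proof -
    have "i = 0 \<or> i = 2 \<or> i = 4 \<or> i = 6" "j = 1 \<or> j = 3 \<or> j = 5 \<or> j = 7"
      using less_8[OF that(1)] less_8[OF that(2)] that(3,4) by auto
    then show ?thesis
      using e by (elim disjE) (simp_all add: insert_commute)
  qed
  show "{?a i, ?w i} \<in> edges G" if "i < 8" for i
    using less_8[OF that] e by (elim disjE) (simp_all add: insert_commute)
  show "{?w i, ?w (Suc i mod 8)} \<in> edges G" if "i < 8" for i
    using less_8[OF that] e by (elim disjE) (simp_all add: insert_commute)
  show "{?w i, ?w (i + 4)} \<in> edges G" if "i < 4" for i
  proof -
    have "i = 0 \<or> i = 1 \<or> i = 2 \<or> i = 3"
      using that by linarith
    then show ?thesis
      using e by (elim disjE) (simp_all add: insert_commute)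
  qed
qed

theorem mainTheorem4:
  shows "\<not> semi_transitive S \<and> \<not> semi_transitive (kneser 8 3)"
proof -
  have sub: "edges S \<subseteq> edges (kneser 8 3)"
    using subgraph_S_kneser by (simp add: subgraph_def)
  have tf: "triangle_free (kneser 8 3)"
    by (rule triangle_free_kneser) simp
  show ?thesis
    using no_semi_transitive_orientation_above_S[OF _ triangle_free_subgraph[OF tf sub]]
      no_semi_transitive_orientation_above_S[OF sub tf]
    by blast
qed

end
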